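(* Every spatial QoS satisfaction game with $N$ players has the finite improvement property. Moreover, any asynchronous better response update process will reach a pure Nash equilibrium within $4N+3N^2$ asynchronous better response updates, irrespective of the initial strategy profile and of the order in which the players update.
   Context: A spatial QoS satisfaction game is a quadruple $(\mathcal{N},\mathcal{C},(T_n^c)_{n\in\mathcal{N},c\in\mathcal{C}},G)$ where $\mathcal{N}=\{1,\ldots,N\}$ is the set of players (users), $\mathcal{C}=\{1,\ldots,C\}$ is the set of channels, $T_n^c\in\{0,1,\ldots,N+1\}$ are integer thresholds, and $G=(\mathcal{N},\mathcal{E})$ is an undirected unweighted (simple) graph on the player set, the interference graph. Each player's strategy set is $\tilde{\mathcal{C}}=\{0,1,\ldots,C\}$, where $0$ is the dormant state. A strategy profile is $\boldsymbol{x}=(x_1,\ldots,x_N)\in\tilde{\mathcal{C}}^N$. The neighborhood of player $n$ is $\mathrm{Ne}(n)=\{m:\{n,m\}\in\mathcal{E}\}\cup\{n\}$, and the local congestion level of channel $c$ for player $n$ is $I_n^c(\boldsymbol{x})=|\{m\in\mathrm{Ne}(n):x_m=c\}|$. The utility of player $n$ is $U_n(\boldsymbol{x})=1$ if $x_n\ne0$ and $I_n^{x_n}(\boldsymbol{x})\le T_n^{x_n}$; $U_n(\boldsymbol{x})=0$ if $x_n=0$; and $U_n(\boldsymbol{x})=-1$ if $x_n\ne0$ and $I_n^{x_n}(\boldsymbol{x})>T_n^{x_n}$. A better response update is a change by a single player $n$ of its strategy from $x_n$ to $c\in\tilde{\mathcal{C}}$, all other strategies being unchanged, such that $U_n$ strictly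 increases. A strategy profile is a pure Nash equilibrium if no player can perform a better response update. An asynchronous better response update process is a sequence of strategy profiles in which each profile is obtained from the previous one by a better response update of exactly one player (and which continues as long as some better response update is possible). A game has the finite improvement property if any asynchronous better response update process terminates at a pure Nash equilibrium within a finite number of updates. *)

theory Defs
  imports Main "HOL-Library.FuncSet" "HOL-Library.Extended_Nat"
begin

section \<open>Games, better responses and the finite improvement property\<close>

text \<open>A game is given by a player set \<open>P\<close>, a common strategy set \<open>S\<close> and utilities
  \<open>U n x\<close> of player \<open>n\<close> under the strategy profile \<open>x\<close>. Profiles are extensional
  functions, so that they correspond exactly to the tuples indexed by \<open>P\<close>.\<close>

definition profiles :: "'p set \<Rightarrow> 's set \<Rightarrow> ('p \<Rightarrow> 's) set" where
  "profiles P S = P \<rightarrow>\<^sub>E S"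

definition better_response_update ::
  "'p set \<Rightarrow> 's set \<Rightarrow> ('p \<Rightarrow> ('p \<Rightarrow> 's) \<Rightarrow> 'u::linorder) \<Rightarrow> ('p \<Rightarrow> 's) \<Rightarrow> ('p \<Rightarrow> 's) \<Rightarrow> bool" where
  "better_response_update P S U x y \<longleftrightarrow>
     (\<exists>n\<in>P. \<exists>c\<in>S. y = x(n := c) \<and> U n x < U n y)"

definition pure_nash_equilibrium ::
  "'p set \<Rightarrow> 's set \<Rightarrow> ('p \<Rightarrow> ('p \<Rightarrow> 's) \<Rightarrow> 'u::linorder) \<Rightarrow> ('p \<Rightarrow> 's) \<Rightarrow> bool" where
  "pure_nash_equilibrium P S U x \<longleftrightarrow>
     x \<in> profiles P S \<and> \<not> (\<exists>y. better_response_update P S U x y)"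

text \<open>A process is a finite or infinite sequence \<open>X 0, X 1, \<dots>\<close> making \<open>L\<close> updates in total,
  where \<open>L = \<infinity>\<close> is allowed. If \<open>L\<close> is finite, only \<open>X 0, \<dots>, X L\<close> belong to the
  process, and it may stop at \<open>X L\<close> only if no further better response update is possible.\<close>

definition better_response_process ::
  "'p set \<Rightarrow> 's set \<Rightarrow> ('p \<Rightarrow> ('p \<Rightarrow> 's) \<Rightarrow> 'u::linorder) \<Rightarrow> (nat \<Rightarrow> 'p \<Rightarrow> 's) \<Rightarrow> enat \<Rightarrow> bool" where
  "better_response_process P S U X L \<longleftrightarrow>
     X 0 \<in> profiles P S \<and>
     (\<forall>i. enat i < L \<longrightarrow> better_response_update P S U (X i) (X (Suc i))) \<and>
     (\<forall>k. L = enat k \<longrightarrow> \<not> (\<exists>y. better_response_update P S U (X k) y))"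

definition finite_improvement_property ::
  "'p set \<Rightarrow> 's set \<Rightarrow> ('p \<Rightarrow> ('p \<Rightarrow> 's) \<Rightarrow> 'u::linorder) \<Rightarrow> bool" where
  "finite_improvement_property P S U \<longleftrightarrow>
     (\<forall>X L. better_response_process P S U X L \<longrightarrow>
        (\<exists>k. L = enat k \<and> pure_nash_equilibrium P S U (X k)))"

section \<open>Spatial QoS satisfaction games\<close>

text \<open>Players are \<open>{1..N}\<close>, channels are \<open>{1..C}\<close>, and strategy \<open>0\<close> is the dormant state.
  \<open>T n c\<close> is the threshold of player \<open>n\<close> on channel \<open>c\<close>; \<open>E\<close> is the set of
  edges of the interference graph, each edge being a two-element set of players.\<close>

definition spatial_QoS_game ::
  "nat \<Rightarrow> nat \<Rightarrow> (nat \<Rightarrow> nat \<Rightarrow> nat) \<Rightarrow> nat set set \<Rightarrow> bool" where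
  "spatial_QoS_game N C T E \<longleftrightarrow>
     (\<forall>n\<in>{1..N}. \<forall>c\<in>{1..C}. T n c \<in> {0..N + 1}) \<and>
     (\<forall>e\<in>E. e \<subseteq> {1..N} \<and> card e = 2)"

definition neighborhood :: "nat set set \<Rightarrow> nat \<Rightarrow> nat set" where
  "neighborhood E n = {m. {n, m} \<in> E} \<union> {n}"

definition congestion :: "nat set set \<Rightarrow> nat \<Rightarrow> nat \<Rightarrow> (nat \<Rightarrow> nat) \<Rightarrow> nat" where
  "congestion E n c x = card {m \<in> neighborhood E n. x m = c}"

definition QoS_utility ::
  "(nat \<Rightarrow> nat \<Rightarrow> nat) \<Rightarrow> nat set set \<Rightarrow> nat \<Rightarrow> (nat \<Rightarrow> nat) \<Rightarrow> int" where
  "QoS_utility T E n x =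
     (if x n = 0 then 0
      else if congestion E n (x n) x \<le> T n (x n) then 1
      else - 1)"

end

theory Submission
  imports Defs
begin

text \<open>The integer potential is the sum of \<open>2 * T n (x n) - I n (x n)\<close> over the active players,
  where \<open>I n c\<close> is the congestion of channel \<open>c\<close> for player \<open>n\<close>.
  If player \<open>n\<close> is active on channel \<open>c\<close> with congestion \<open>I\<close>, putting \<open>n\<close> to sleep removes
  the term \<open>2 * T n c - I\<close> and lowers the congestion of each of the \<open>I - 1\<close> neighbours of \<open>n\<close>
  on \<open>c\<close> by one, so the contribution of \<open>n\<close> is \<open>2 * (T n c - I) + 1\<close>. This odd number is
  positive iff \<open>n\<close> is satisfied, while a dormant player contributes \<open>0\<close>. Hence each better response
  update increases the potential, which lies between \<open>- N ^ 2\<close> and \<open>2 * N * (N + 1)\<close>.\<close>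

lemma better_response_update_in_profiles:
  assumes "better_response_update P S U x y" "x \<in> profiles P S"
  shows "y \<in> profiles P S"
  using assms unfolding better_response_update_def profiles_def
  by (auto simp: PiE_iff extensional_def)

text \<open>An integer that strictly increases grows by at least 1 per update, so \<open>k\<close>
  updates force \<open>a + k \<le> b\<close>. This rules out an infinite process, and a finite one
  may stop only where no update is left.\<close>

lemma better_response_process_bounded:
  fixes \<Phi> :: "('p \<Rightarrow> 's) \<Rightarrow> int"
  assumes process: "better_response_process P S U X L"
    and incr: "\<And>x y. x \<in> profiles P S \<Longrightarrow> better_response_update P S U x y \<Longrightarrow> \<Phi> x < \<Phi> y"
    and lower: "\<And>x. x \<in> profiles P S \<Longrightarrow> a \<le> \<Phi> x"
    and upper: "\<And>x. x \<in> profiles P S \<Longrightarrow> \<Phi> x \<le> b"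
  shows "\<exists>k. L = enat k \<and> int k \<le> b - a \<and> pure_nash_equilibrium P S U (X k)"
proof -
  have start: "X 0 \<in> profiles P S"
    and step: "\<And>i. enat i < L \<Longrightarrow> better_response_update P S U (X i) (X (Suc i))"
    and stop: "\<And>k. L = enat k \<Longrightarrow> \<not> (\<exists>y. better_response_update P S U (X k) y)"
    using process unfolding better_response_process_def by auto
  have run: "X k \<in> profiles P S \<and> \<Phi> (X 0) + int k \<le> \<Phi> (X k)" if "enat k \<le> L" for k
    using that
  proof (induction k)
    case 0
    then show ?case using start by simp
  next
    case (Suc k)
    have "enat k < enat (Suc k)"
      by simp
    with Suc.prems have less: "enat k < L"
      by (rule less_le_trans[rotated])
    then have IH: "X k \<in> profiles P S" "\<Phi> (X 0) + int k \<le> \<Phi> (X k)"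
      using Suc.IH by auto
    show ?case
      using better_response_update_in_profiles[OF step[OF less] IH(1)]
        incr[OF IH(1) step[OF less]] IH(2) by auto
  qed
  have bound: "int k \<le> b - a" if "enat k \<le> L" for k
    using run[OF that] lower[OF start] upper[of "X k"] by linarith
  have "L \<noteq> \<infinity>"
  proof
    assume "L = \<infinity>"
    \<comment> \<open>An infinite process would contain one update more than the bound
      permits.\<close>
    then have "int (nat (b - a + 1)) \<le> b - a"
      by (intro bound) simp
    then show False
      by linarith
  qed
  then obtain k where k: "L = enat k"
    by auto
  then show ?thesis
    using bound[of k] run[of k] stop[OF k] unfolding pure_nash_equilibrium_def by auto
qed

definition QoS_potential ::
  "nat \<Rightarrow> (nat \<Rightarrow> nat \<Rightarrow> nat) \<Rightarrow> nat set set \<Rightarrow> (nat \<Rightarrow> nat) \<Rightarrow> int" where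
  "QoS_potential N T E x =
     (\<Sum>n\<in>{1..N}. if x n = 0 then 0 else 2 * int (T n (x n)) - int (congestion E n (x n) x))"

definition contribution ::
  "(nat \<Rightarrow> nat \<Rightarrow> nat) \<Rightarrow> nat set set \<Rightarrow> nat \<Rightarrow> (nat \<Rightarrow> nat) \<Rightarrow> int" where
  "contribution T E n x =
     (if x n = 0 then 0 else 2 * (int (T n (x n)) - int (congestion E n (x n) x)) + 1)"

text \<open>The utility is the sign of the contribution, which is odd, hence nonzero, for an active
  player.\<close>

lemma contribution_less:
  assumes "QoS_utility T E n x < QoS_utility T E n y"
  shows "contribution T E n x < contribution T E n y"
  using assms unfolding QoS_utility_def contribution_def by (auto split: if_splits)

lemma self_in_neighborhood: "n \<in> neighborhood E n"
  by (simp add: neighborhood_def)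

lemma neighborhood_commute: "m \<in> neighborhood E n \<longleftrightarrow> n \<in> neighborhood E m"
  by (auto simp: neighborhood_def insert_commute)

context
  fixes N C :: nat and T :: "nat \<Rightarrow> nat \<Rightarrow> nat" and E :: "nat set set"
  assumes game: "spatial_QoS_game N C T E"
begin

lemma neighborhood_subset: "n \<in> {1..N} \<Longrightarrow> neighborhood E n \<subseteq> {1..N}"
  using game unfolding spatial_QoS_game_def neighborhood_def by fastforce

lemma congestion_le:
  assumes "n \<in> {1..N}"
  shows "congestion E n c x \<le> N"
proof -
  have "card {m \<in> neighborhood E n. x m = c} \<le> card {1..N}"
    using neighborhood_subset[OF assms] by (intro card_mono) auto
  then show ?thesis
    by (simp add: congestion_def)
qed

text \<open>Putting \<open>n\<close> to sleep only removes \<open>n\<close> from its own channel.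
  Symmetry of the neighbourhood relation turns "\<open>m\<close> sees \<open>n\<close>" into
  "\<open>n\<close> sees \<open>m\<close>", the form summed over \<open>m\<close> later.\<close>

lemma congestion_dormant:
  assumes "m \<in> {1..N}" "x m \<noteq> 0"
  shows "congestion E m (x m) x =
    congestion E m (x m) (x(n := 0)) + of_bool (m \<in> neighborhood E n \<and> x m = x n)"
proof -
  let ?A = "{k \<in> neighborhood E m. x k = x m}"
  let ?B = "{k \<in> neighborhood E m. (x(n := 0)) k = x m}"
  have fin: "finite ?B"
    using finite_subset[OF neighborhood_subset[OF assms(1)]] by simp
  show ?thesis
  proof (cases "n \<in> neighborhood E m \<and> x n = x m")
    case True
    \<comment> \<open>As \<open>x m\<close> is not \<open>0\<close>, the sleeping \<open>n\<close>
      is no longer counted.\<close>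
    then have "?A = insert n ?B" "n \<notin> ?B"
      using assms(2) by auto
    then show ?thesis
      using fin True neighborhood_commute[of m E n] by (simp add: congestion_def)
  next
    case False
    then have eq: "?A = ?B"
      using assms(2) by auto
    have "\<not> (m \<in> neighborhood E n \<and> x m = x n)"
      using False neighborhood_commute[of m E n] by metis
    then show ?thesis
      unfolding congestion_def eq by simp
  qed
qed

lemma QoS_potential_dormant:
  assumes n: "n \<in> {1..N}"
  shows "QoS_potential N T E x = QoS_potential N T E (x(n := 0)) + contribution T E n x"
proof (cases "x n = 0")
  case True
  then have "x(n := 0) = x"
    by auto
  then show ?thesis
    using True by (simp add: contribution_def)
next
  case False
  let ?f = "\<lambda>x m. if x m = 0 then 0 else 2 * int (T m (x m)) - int (congestion E m (x m) x)"
  let ?M = "{m \<in> {1..N} - {n}. m \<in> neighborhood E n \<and> x m = x n}"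
  have split: "QoS_potential N T E z = ?f z n + (\<Sum>m\<in>{1..N} - {n}. ?f z m)" for z
    unfolding QoS_potential_def by (rule sum.remove) (use n in auto)
  \<comment> \<open>For dormant \<open>m\<close> the correction vanishes, since \<open>x n\<close>
    is not \<open>0\<close>.\<close>
  have others: "(\<Sum>m\<in>{1..N} - {n}. ?f x m) =
      (\<Sum>m\<in>{1..N} - {n}. ?f (x(n := 0)) m - of_bool (m \<in> neighborhood E n \<and> x m = x n))"
    using False by (intro sum.cong) (auto simp: congestion_dormant[of _ x n])
  \<comment> \<open>Player \<open>n\<close> counts itself, so only congestion minus one others are
    affected; hence the \<open>+ 1\<close> in \<open>contribution\<close>.\<close>
  have "{m \<in> neighborhood E n. x m = x n} = insert n ?M"
    using neighborhood_subset[OF n] self_in_neighborhood[of n E]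
    by auto
  then have "congestion E n (x n) x = Suc (card ?M)"
    by (simp add: congestion_def)
  moreover have "(\<Sum>m\<in>{1..N} - {n}. of_bool (m \<in> neighborhood E n \<and> x m = x n)) = int (card ?M)"
    by (subst sum_of_bool_eq) (auto intro: arg_cong[where f = card])
  ultimately show ?thesis
    using False others unfolding split[of x] split[of "x(n := 0)"]
    by (simp add: sum_subtractf contribution_def)
qed

lemma QoS_potential_less:
  assumes "better_response_update {1..N} {0..C} (QoS_utility T E) x y"
  shows "QoS_potential N T E x < QoS_potential N T E y"
proof -
  obtain n c where n: "n \<in> {1..N}" and y: "y = x(n := c)"
    and "QoS_utility T E n x < QoS_utility T E n y"
    using assms unfolding better_response_update_def by auto
  then have "contribution T E n x < contribution T E n y"
    by (intro contribution_less)
  \<comment> \<open>The common profile with \<open>n\<close> asleep cancels, so the potential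
    changes exactly as the contribution of \<open>n\<close>.\<close>
  moreover have "y(n := 0) = x(n := 0)"
    by (simp add: y)
  ultimately show ?thesis
    using QoS_potential_dormant[OF n, of x] QoS_potential_dormant[OF n, of y] by simp
qed

lemma QoS_potential_lower: "- int (N ^ 2) \<le> QoS_potential N T E x"
proof -
  have "(\<Sum>n\<in>{1..N}. - int N) \<le> QoS_potential N T E x"
    unfolding QoS_potential_def
  proof (rule sum_mono)
    fix n assume "n \<in> {1..N}"
    then show "- int N \<le>
      (if x n = 0 then 0 else 2 * int (T n (x n)) - int (congestion E n (x n) x))"
      using congestion_le[of n "x n" x] by simp
  qed
  then show ?thesis
    by (simp add: power2_eq_square)
qed

lemma QoS_potential_upper:
  assumes "x \<in> profiles {1..N} {0..C}"
  shows "QoS_potential N T E x \<le> int (2 * N * (N + 1))"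
proof -
  have "QoS_potential N T E x \<le> (\<Sum>n\<in>{1..N}. 2 * int (N + 1))"
    unfolding QoS_potential_def
  proof (rule sum_mono)
    fix n assume n: "n \<in> {1..N}"
    \<comment> \<open>Thresholds are bounded only on channels, so \<open>x n\<close> must be shown
      to be one when it is nonzero.\<close>
    then have "x n \<in> {0..C}"
      using assms unfolding profiles_def by (rule PiE_mem[rotated])
    then have "T n (x n) \<le> N + 1" if "x n \<noteq> 0"
      using game n that unfolding spatial_QoS_game_def by auto
    then show "(if x n = 0 then 0 else 2 * int (T n (x n)) - int (congestion E n (x n) x))
        \<le> 2 * int (N + 1)"
      by auto
  qed
  then show ?thesis
    by (simp add: algebra_simps)
qed

end

theorem theorem7:
  fixes N C :: nat
    and T :: "nat \<Rightarrow> nat \<Rightarrow> nat"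
    and E :: "nat set set"
  assumes "spatial_QoS_game N C T E"
  shows "finite_improvement_property {1..N} {0..C} (QoS_utility T E)
    \<and> (\<forall>X L. better_response_process {1..N} {0..C} (QoS_utility T E) X L \<longrightarrow>
         (\<exists>k. L = enat k \<and> k \<le> 4 * N + 3 * N ^ 2
            \<and> pure_nash_equilibrium {1..N} {0..C} (QoS_utility T E) (X k)))"
proof -
  have "\<exists>k. L = enat k \<and> k \<le> 4 * N + 3 * N ^ 2
      \<and> pure_nash_equilibrium {1..N} {0..C} (QoS_utility T E) (X k)"
    if process: "better_response_process {1..N} {0..C} (QoS_utility T E) X L" for X L
  proof -
    obtain k where k: "L = enat k" "pure_nash_equilibrium {1..N} {0..C} (QoS_utility T E) (X k)"
      and "int k \<le> int (2 * N * (N + 1)) - (- int (N ^ 2))"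
      using better_response_process_bounded[where \<Phi> = "QoS_potential N T E",
          OF process QoS_potential_less[OF assms]
            QoS_potential_lower[OF assms] QoS_potential_upper[OF assms]]
      by blast
    then have "k \<le> 2 * N * (N + 1) + N ^ 2"
      by linarith
    \<comment> \<open>The left side equals \<open>2 * N + 3 * N ^ 2\<close>.\<close>
    also have "\<dots> \<le> 4 * N + 3 * N ^ 2"
      by (simp add: power2_eq_square algebra_simps)
    finally show ?thesis
      using k by blast
  qed
  then show ?thesis
    unfolding finite_improvement_property_def by blast
qed

end
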